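(* Let $\Sigma_1=(G_1,\sigma_1)$ and $\Sigma_2=(G_2,\sigma_2)$ be two finite, simple, connected signed graphs and let $\Sigma_1\boxtimes\Sigma_2$ be their strong product. Then $$\operatorname{bdim}(\Sigma_1\boxtimes\Sigma_2)=\begin{cases}\operatorname{bdim}(\Sigma_1), & \text{if } \Sigma_2 \text{ is balanced},\\ \operatorname{bdim}(\Sigma_2), & \text{if } \Sigma_1 \text{ is balanced}.\end{cases}$$
   Context: A signed graph $\Sigma=(G,\sigma)$ is a graph $G=(V,E)$ with a function $\sigma:E\to\{+1,-1\}$. All graphs are finite, simple, connected and undirected unless otherwise mentioned. The sign of a cycle is the product of the signs of its edges; $\Sigma$ is balanced if it has no cycle of sign $-1$. Let $\Omega=\{-1,0,1\}$, with $\Omega^k\subset\mathbb{R}^k$ carrying the standard inner product $\langle\cdot,\cdot\rangle$. A vector valued switching function ($k$-switching function) for $\Sigma$ is a map $\zeta:V\to\Omega^k$ with $\langle\zeta(u),\zeta(v)\rangle\neq 0$ for every edge $uv\in E$; the switched signed graph $\Sigma^\zeta=(G,\sigma^\zeta)$ has $\sigma^\zeta(uv)=\sigma(uv)\operatorname{sgn}(\langle\zeta(u),\zeta(v)\rangle)$. The balancing dimension $\operatorname{bdim}(\Sigma)$ is the least integer $k\ge 1$ for which there is a $k$-switching function $\zeta:V\to\Omega^k$ such that $\Sigma^\zeta$ is all-positive (every edge has sign $+1$). The strong product $\Sigma_1\boxtimes\Sigma_2$ is the signed graph on the strong product $G_1\boxtimes G_2$ of the underlying graphs with signature $$\sigma((u_i,v_j)(u_k,v_l))=\begin{cases}\sigma_1(u_iu_k)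 & \text{if } u_i\sim u_k\text{ and } v_j=v_l,\\ \sigma_2(v_jv_l) & \text{if } u_i=u_k\text{ and } v_j\sim v_l,\\ \sigma_1(u_iu_k)\sigma_2(v_jv_l) & \text{if } u_i\sim u_k\text{ and } v_j\sim v_l.\end{cases}$$ *)

theory Defs
  imports "Graph_Theory.Digraph_Component" "Jordan_Normal_Form.Matrix"
begin

text \<open>
  Following Graph_Theory, an undirected graph is a symmetric loop-free digraph without
  parallel arcs (locale \<open>pair_graph\<close>, which includes finiteness): an edge \<open>uv\<close> is
  the pair of arcs \<open>(u,v)\<close>, \<open>(v,u)\<close>.  Hence a signature on edges is a function on
  arcs that agrees on both orientations.  Its values on pairs that are not arcs are irrelevant.
\<close>

record 'a sgraph =
  ugraph :: "'a pair_pre_digraph"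
  signature :: "'a \<times> 'a \<Rightarrow> real"

definition signed_graph :: "'a sgraph \<Rightarrow> bool" where
  "signed_graph S \<longleftrightarrow> pair_graph (ugraph S) \<and>
     (\<forall>(u, v) \<in> parcs (ugraph S). signature S (u, v) \<in> {1, - 1} \<and> signature S (v, u) = signature S (u, v))"

text \<open>The library notion of connectedness excludes the graph without vertices.\<close>

definition connected_signed_graph :: "'a sgraph \<Rightarrow> bool" where
  "connected_signed_graph S \<longleftrightarrow> signed_graph S \<and> Digraph_Component.connected (with_proj (ugraph S))"

text \<open>
  The bound on the length excludes the directed cycles \<open>(u,v), (v,u)\<close>, which run
  through a single edge twice and are not cycles of the undirected graph.
\<close>

definition undirected_cycle :: "'a sgraph \<Rightarrow> ('a \<times> 'a) awalk \<Rightarrow> bool" where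
  "undirected_cycle S p \<longleftrightarrow> pre_digraph.cycle (with_proj (ugraph S)) p \<and> 3 \<le> length p"

definition cycle_sign :: "'a sgraph \<Rightarrow> ('a \<times> 'a) awalk \<Rightarrow> real" where
  "cycle_sign S p = prod_list (map (signature S) p)"

definition balanced :: "'a sgraph \<Rightarrow> bool" where
  "balanced S \<longleftrightarrow> \<not> (\<exists>p. undirected_cycle S p \<and> cycle_sign S p = - 1)"

definition all_positive :: "'a sgraph \<Rightarrow> bool" where
  "all_positive S \<longleftrightarrow> (\<forall>e \<in> parcs (ugraph S). signature S e = 1)"

definition Omega :: "nat \<Rightarrow> real vec set" where
  "Omega k = {x \<in> carrier_vec k. \<forall>i < k. x $ i \<in> {- 1, 0, 1}}"

definition switching_function :: "nat \<Rightarrow> 'a sgraph \<Rightarrow> ('a \<Rightarrow> real vec) \<Rightarrow> bool" where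
  "switching_function k S \<zeta> \<longleftrightarrow> (\<forall>v \<in> pverts (ugraph S). \<zeta> v \<in> Omega k) \<and>
     (\<forall>(u, v) \<in> parcs (ugraph S). \<zeta> u \<bullet> \<zeta> v \<noteq> 0)"

definition switched :: "('a \<Rightarrow> real vec) \<Rightarrow> 'a sgraph \<Rightarrow> 'a sgraph" where
  "switched \<zeta> S = S\<lparr>signature := (\<lambda>(u, v). signature S (u, v) * sgn (\<zeta> u \<bullet> \<zeta> v))\<rparr>"

definition bdim :: "'a sgraph \<Rightarrow> nat" where
  "bdim S = (LEAST k. 1 \<le> k \<and> (\<exists>\<zeta>. switching_function k S \<zeta> \<and> all_positive (switched \<zeta> S)))"

definition strong_product_graph ::
    "'a pair_pre_digraph \<Rightarrow> 'b pair_pre_digraph \<Rightarrow> ('a \<times> 'b) pair_pre_digraph" where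
  "strong_product_graph G H = \<lparr>
     pverts = pverts G \<times> pverts H,
     parcs = {((u, v), (u', v')) | u v u' v'.
       (u, u') \<in> parcs G \<and> v = v' \<and> v \<in> pverts H \<or>
       u = u' \<and> u \<in> pverts G \<and> (v, v') \<in> parcs H \<or>
       (u, u') \<in> parcs G \<and> (v, v') \<in> parcs H} \<rparr>"

definition strong_product :: "'a sgraph \<Rightarrow> 'b sgraph \<Rightarrow> ('a \<times> 'b) sgraph" where
  "strong_product S T = \<lparr>
     ugraph = strong_product_graph (ugraph S) (ugraph T),
     signature = (\<lambda>((u, v), (u', v')).
       if v = v' then signature S (u, u')
       else if u = u' then signature T (v, v')
       else signature S (u, u') * signature T (v, v')) \<rparr>"

lemma signed_graph_strong_product:
  assumes "signed_graph S" "signed_graph T"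
  shows "signed_graph (strong_product S T)"
proof -
  interpret G: pair_graph "ugraph S" using assms(1) by (simp add: signed_graph_def)
  interpret H: pair_graph "ugraph T" using assms(2) by (simp add: signed_graph_def)
  let ?P = "strong_product_graph (ugraph S) (ugraph T)"
  have sub: "parcs ?P \<subseteq> pverts ?P \<times> pverts ?P"
    by (auto simp: strong_product_graph_def dest: G.in_arcsD1 G.in_arcsD2 H.in_arcsD1 H.in_arcsD2)
  have fin: "finite (pverts ?P)"
    using G.pair_finite_verts H.pair_finite_verts by (simp add: strong_product_graph_def)
  have mem: "((u, v), (u', v')) \<in> parcs ?P \<longleftrightarrow>
       (u, u') \<in> parcs (ugraph S) \<and> v = v' \<and> v \<in> pverts (ugraph T) \<or>
       u = u' \<and> u \<in> pverts (ugraph S) \<and> (v, v') \<in> parcs (ugraph T) \<or>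
       (u, u') \<in> parcs (ugraph S) \<and> (v, v') \<in> parcs (ugraph T)" for u v u' v'
    by (simp add: strong_product_graph_def)
  have wf: "pair_wf_digraph ?P"
    by unfold_locales (use sub in auto)
  have "pair_graph ?P"
  proof (intro pair_graph.intro pair_digraph.intro pair_pseudo_graph.intro
      pair_fin_digraph.intro pair_sym_digraph.intro pair_loopfree_digraph.intro wf)
    show "pair_fin_digraph_axioms ?P"
      using fin finite_subset[OF sub] by unfold_locales simp_all
    then show "pair_fin_digraph_axioms ?P" .
    show "pair_sym_digraph_axioms ?P"
    proof
      show "symmetric (with_proj ?P)"
        unfolding symmetric_def with_proj_simps
      proof (rule symI)
        fix x y assume "(x, y) \<in> parcs ?P"
        then show "(y, x) \<in> parcs ?P"
          using G.arcs_symmetric H.arcs_symmetric by (cases x; cases y) (simp add: mem, blast)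
      qed
    qed
    show "pair_loopfree_digraph_axioms ?P"
    proof
      fix e assume "e \<in> parcs ?P"
      then show "fst e \<noteq> snd e"
        using G.no_loops' H.no_loops' by (cases e; cases "fst e"; cases "snd e") (simp add: mem, blast)
    qed
  qed
  moreover have "signature (strong_product S T) (x, y) \<in> {1, - 1} \<and>
      signature (strong_product S T) (y, x) = signature (strong_product S T) (x, y)"
    if xy: "(x, y) \<in> parcs ?P" for x y
  proof -
    obtain u v u' v' where eq: "x = (u, v)" "y = (u', v')" by (cases x, cases y)
    have S: "signature S (u, u') \<in> {1, - 1} \<and> signature S (u', u) = signature S (u, u') \<and> u \<noteq> u'"
      if "(u, u') \<in> parcs (ugraph S)"
      using assms(1) that G.no_loops'[OF that] by (auto simp: signed_graph_def)
    have T: "signature T (v, v') \<in> {1, - 1} \<and> signature T (v', v) = signature T (v, v') \<and> v \<noteq> v'"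
      if "(v, v') \<in> parcs (ugraph T)"
      using assms(2) that H.no_loops'[OF that] by (auto simp: signed_graph_def)
    from xy[unfolded eq mem] show ?thesis
      unfolding eq strong_product_def by (elim disjE conjE) (use S T in auto)
  qed
  ultimately show ?thesis
    by (auto simp: signed_graph_def strong_product_def)
qed

text \<open>
  The minimum defining \<open>bdim\<close> is attained: index the coordinates by the arcs \<open>(a,b)\<close>
  and let \<open>\<zeta> a\<close>, \<open>\<zeta> b\<close> have entries \<open>1\<close>, \<open>signature S (a,b)\<close> there.
\<close>

lemma bdim_attained:
  assumes "signed_graph S"
  shows "1 \<le> bdim S \<and> (\<exists>\<zeta>. switching_function (bdim S) S \<zeta> \<and> all_positive (switched \<zeta> S))"
proof -
  interpret G: pair_graph "ugraph S" using assms by (simp add: signed_graph_def)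
  let ?A = "parcs (ugraph S)"
  have "\<exists>k. 1 \<le> k \<and> (\<exists>\<zeta>. switching_function k S \<zeta> \<and> all_positive (switched \<zeta> S))"
  proof (cases "?A = {}")
    case True
    have "switching_function 1 S (\<lambda>_. 0\<^sub>v 1)" "all_positive (switched (\<lambda>_. 0\<^sub>v 1) S)"
      using True by (auto simp: switching_function_def Omega_def all_positive_def switched_def)
    then show ?thesis by blast
  next
    case False
    obtain f where f: "bij_betw f {0..<card ?A} ?A"
      using ex_bij_betw_nat_finite[OF G.pair_finite_arcs] by blast
    define g where "g v e = (if v = fst e then 1 else if v = snd e then signature S e else 0)" for v e
    define \<zeta> where "\<zeta> v = vec (card ?A) (\<lambda>i. g v (f i))" for v
    have g: "g v e \<in> {-1, 0, 1}" if "e \<in> ?A" for v e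
      using assms that by (auto simp: g_def signed_graph_def)
    have prod: "\<zeta> u \<bullet> \<zeta> v = 2 * signature S (u, v)" if uv: "(u, v) \<in> ?A" for u v
    proof -
      have ne: "u \<noteq> v" using uv by (rule G.no_loops')
      have vu: "(v, u) \<in> ?A" using uv by (rule G.arcs_symmetric)
      have "\<zeta> u \<bullet> \<zeta> v = (\<Sum>i\<in>{0..<card ?A}. g u (f i) * g v (f i))"
        by (simp add: scalar_prod_def \<zeta>_def)
      also have "\<dots> = (\<Sum>e\<in>?A. g u e * g v e)"
        by (rule sum.reindex_bij_betw[OF f])
      also have "\<dots> = (\<Sum>e\<in>{(u, v), (v, u)}. g u e * g v e)"
        by (rule sum.mono_neutral_right) (use uv vu ne in \<open>auto simp: g_def\<close>)
      also have "\<dots> = 2 * signature S (u, v)"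
        using ne uv assms by (auto simp: g_def signed_graph_def)
      finally show ?thesis .
    qed
    have sgn: "signature S e = 1 \<or> signature S e = - 1" if "e \<in> ?A" for e
      using assms that by (auto simp: signed_graph_def)
    have "f i \<in> ?A" if "i < card ?A" for i
      using f that by (auto simp: bij_betw_def)
    with g have "g v (f i) \<in> {- 1, 0, 1}" if "i < card ?A" for v i
      using that by blast
    then have "\<zeta> v \<in> Omega (card ?A)" for v
      by (simp add: Omega_def \<zeta>_def)
    moreover have "\<zeta> u \<bullet> \<zeta> v \<noteq> 0" if "(u, v) \<in> ?A" for u v
      using prod[OF that] sgn[OF that] by auto
    ultimately have "switching_function (card ?A) S \<zeta>"
      unfolding switching_function_def by blast
    moreover have "signature (switched \<zeta> S) (u, v) = 1" if "(u, v) \<in> ?A" for u v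
      using prod[OF that] sgn[OF that] by (auto simp: switched_def)
    then have "all_positive (switched \<zeta> S)"
      unfolding all_positive_def by (auto simp: switched_def)
    moreover have "1 \<le> card ?A"
      using False G.pair_finite_arcs by (simp add: Suc_le_eq card_gt_0_iff)
    ultimately show ?thesis by blast
  qed
  then show ?thesis unfolding bdim_def by (rule LeastI_ex)
qed

end

theory Submission
  imports Defs
begin

text \<open>
  A balanced connected signature is a coboundary \<open>\<sigma>(uv) = \<theta>(u) \<theta>(v)\<close> with \<open>\<theta> = \<plusminus>1\<close> (Harary).  If \<open>\<Sigma>\<^sub>2\<close> has
  such a potential and \<open>\<zeta>\<close> makes \<open>\<Sigma>\<^sub>1\<close> all-positive with \<open>\<zeta>\<close> nowhere zero
  (zeros can only occur at isolated vertices and are harmlessly replaced there), then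
  \<open>(u, v) \<mapsto> \<theta>(v) \<zeta>(u)\<close> makes the product all-positive in the same dimension.  Conversely \<open>\<Sigma>\<^sub>1\<close> sits
  in the product as a layer, and switching functions restrict.
\<close>

section \<open>Switchings to the all-positive signature\<close>

definition positive_switching :: "nat \<Rightarrow> 'a sgraph \<Rightarrow> ('a \<Rightarrow> real vec) \<Rightarrow> bool" where
  "positive_switching k S \<zeta> \<longleftrightarrow> (\<forall>v \<in> pverts (ugraph S). \<zeta> v \<in> Omega k) \<and>
     (\<forall>u v. (u, v) \<in> parcs (ugraph S) \<longrightarrow> signature S (u, v) * sgn (\<zeta> u \<bullet> \<zeta> v) = 1)"

text \<open>Since \<open>sgn 0 = 0\<close>, the sign equation on an arc already forces the inner
  product to be nonzero.\<close>

lemma positive_switching_iff: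
  "positive_switching k S \<zeta> \<longleftrightarrow> switching_function k S \<zeta> \<and> all_positive (switched \<zeta> S)"
proof -
  have "\<zeta> u \<bullet> \<zeta> v \<noteq> 0" if "signature S (u, v) * sgn (\<zeta> u \<bullet> \<zeta> v) = 1" for u v
    using that by auto
  then show ?thesis
    unfolding positive_switching_def switching_function_def all_positive_def switched_def
    by (simp add: Ball_def) blast
qed

lemma bdim_le:
  assumes "1 \<le> k" "positive_switching k S \<zeta>"
  shows "bdim S \<le> k"
  using assms unfolding bdim_def positive_switching_iff by (intro Least_le) blast

lemma bdim_obtain:
  assumes "signed_graph S"
  obtains \<zeta> where "1 \<le> bdim S" "positive_switching (bdim S) S \<zeta>"
  using bdim_attained[OF assms] unfolding positive_switching_iff by blast

text \<open>An optimal switching of \<open>T\<close> pulls back along \<open>f\<close> in the same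
  dimension. This serves both the embedding of a factor as a layer and the exchange of the
  factors.\<close>

lemma bdim_mono_hom:
  assumes "signed_graph T"
    and "\<And>v. v \<in> pverts (ugraph S) \<Longrightarrow> f v \<in> pverts (ugraph T)"
    and "\<And>u v. (u, v) \<in> parcs (ugraph S) \<Longrightarrow>
      (f u, f v) \<in> parcs (ugraph T) \<and> signature T (f u, f v) = signature S (u, v)"
  shows "bdim S \<le> bdim T"
proof -
  obtain \<zeta> where k: "1 \<le> bdim T" and \<zeta>: "positive_switching (bdim T) T \<zeta>"
    using assms(1) by (rule bdim_obtain)
  have "positive_switching (bdim T) S (\<zeta> \<circ> f)"
    using \<zeta> assms(2,3) unfolding positive_switching_def comp_def by metis
  with k show ?thesis by (rule bdim_le)
qed

lemma arc_neq:
  assumes "signed_graph S" "(u, v) \<in> parcs (ugraph S)"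
  shows "u \<noteq> v"
proof -
  interpret pair_graph "ugraph S" using assms(1) by (simp add: signed_graph_def)
  show ?thesis using assms(2) by (rule no_loops')
qed

section \<open>Layers and symmetry of the strong product\<close>

lemma in_parcs_strong_product:
  "((u, v), (u', v')) \<in> parcs (ugraph (strong_product S T)) \<longleftrightarrow>
     (u, u') \<in> parcs (ugraph S) \<and> v = v' \<and> v \<in> pverts (ugraph T) \<or>
     u = u' \<and> u \<in> pverts (ugraph S) \<and> (v, v') \<in> parcs (ugraph T) \<or>
     (u, u') \<in> parcs (ugraph S) \<and> (v, v') \<in> parcs (ugraph T)"
  by (simp add: strong_product_def strong_product_graph_def)

lemma pverts_strong_product:
  "pverts (ugraph (strong_product S T)) = pverts (ugraph S) \<times> pverts (ugraph T)"
  by (simp add: strong_product_def strong_product_graph_def)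

lemma signature_strong_product:
  "signature (strong_product S T) ((u, v), (u', v')) =
     (if v = v' then signature S (u, u')
      else if u = u' then signature T (v, v')
      else signature S (u, u') * signature T (v, v'))"
  by (simp add: strong_product_def)

lemma bdim_strong_product_commute_le:
  assumes "signed_graph S" "signed_graph T"
  shows "bdim (strong_product S T) \<le> bdim (strong_product T S)"
proof (rule bdim_mono_hom[where f = prod.swap])
  show "signed_graph (strong_product T S)"
    using assms by (simp add: signed_graph_strong_product)
  show "prod.swap x \<in> pverts (ugraph (strong_product T S))"
    if "x \<in> pverts (ugraph (strong_product S T))" for x
    using that by (auto simp: pverts_strong_product)
  show "(prod.swap x, prod.swap y) \<in> parcs (ugraph (strong_product T S)) \<and>
      signature (strong_product T S) (prod.swap x, prod.swap y) = signature (strong_product S T) (x, y)"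
    if "(x, y) \<in> parcs (ugraph (strong_product S T))" for x y
    \<comment> \<open>The signature tests \<open>v = v'\<close> before \<open>u = u'\<close>, an
      order that the swap reverses. As the factors have no loops, both equalities never hold on one
      arc.\<close>
    using that arc_neq[OF assms(1)] arc_neq[OF assms(2)]
    by (cases x; cases y) (auto simp: in_parcs_strong_product signature_strong_product)
qed

lemma bdim_strong_product_commute:
  assumes "signed_graph S" "signed_graph T"
  shows "bdim (strong_product S T) = bdim (strong_product T S)"
  using assms by (intro antisym bdim_strong_product_commute_le)

lemma bdim_le_strong_product:
  assumes "signed_graph S" "signed_graph T" "w \<in> pverts (ugraph T)"
  shows "bdim S \<le> bdim (strong_product S T)"
  using assms
  by (intro bdim_mono_hom[where f = "\<lambda>u. (u, w)"])
    (auto simp: signed_graph_strong_product pverts_strong_product in_parcs_strong_product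
       signature_strong_product)

section \<open>Signs of closed walks and the potential of a balanced graph\<close>

lemma cycle_sign_simps [simp]:
  "cycle_sign S [] = 1"
  "cycle_sign S (e # p) = signature S e * cycle_sign S p"
  "cycle_sign S (p @ q) = cycle_sign S p * cycle_sign S q"
  by (simp_all add: cycle_sign_def)

lemma cycle_sign_values:
  assumes "signed_graph S" "set p \<subseteq> parcs (ugraph S)"
  shows "cycle_sign S p = 1 \<or> cycle_sign S p = - 1"
  using assms by (induction p) (auto simp: signed_graph_def)

text \<open>
  A shortest closed walk of sign \<open>- 1\<close> would be a cycle: a repeated vertex splits a closed walk into
  two shorter ones, whose signs multiply to the sign of the whole, and a closed walk of length 2 runs
  back and forth along one edge, so it has sign \<open>1\<close>.
\<close>

lemma balanced_closed_walk_sign: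
  assumes S: "signed_graph S" and bal: "balanced S"
    and walk: "pre_digraph.awalk (with_proj (ugraph S)) u p u"
  shows "cycle_sign S p = 1"
  using walk
\<comment> \<open>The base point varies because the closed piece split off below starts at the
  repeated vertex.\<close>
proof (induction p arbitrary: u rule: length_induct)
  case (1 p)
  interpret G: pair_graph "ugraph S" using S by (simp add: signed_graph_def)
  show ?case
  proof (cases p)
    case Nil
    then show ?thesis by simp
  next
    case (Cons e p')
    then have e: "e \<in> parcs (ugraph S)" "u = fst e" and p': "G.awalk (snd e) p' u"
      using "1.prems" by (auto simp: G.awalk_Cons_iff)
    show ?thesis
    \<comment> \<open>Dropping the first arc leaves the start \<open>u\<close> listed only as the
      end vertex, so its unavoidable repetition does not count.\<close>
    proof (cases "distinct (G.awalk_verts (snd e) p')")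
      case True
      have cyc: "G.cycle p"
        unfolding G.cycle_def using "1.prems" True Cons by auto
      show ?thesis
      proof (cases "3 \<le> length p")
        case True
        with cyc bal have "cycle_sign S p \<noteq> - 1"
          by (auto simp: balanced_def undirected_cycle_def)
        moreover have "set p \<subseteq> parcs (ugraph S)"
          using "1.prems" by (auto simp: G.awalk_def)
        ultimately show ?thesis using cycle_sign_values[OF S] by blast
      next
        case False
        show ?thesis
        proof (cases p')
          case Nil
          with p' e have "fst e = snd e" by (simp add: G.awalk_Nil_iff)
          moreover have "fst e \<noteq> snd e"
            using e by (intro arc_neq[OF S]) simp
          ultimately show ?thesis by blast
        next
          case (Cons d p'')
          with False \<open>p = e # p'\<close> have p: "p = [e, d]" by (cases p'') simp_all
          with \<open>p = e # p'\<close> p' e have "d = (snd e, fst e)"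
            by (auto simp: G.awalk_Cons_iff G.awalk_Nil_iff prod_eq_iff)
          with p e S show ?thesis
            by (cases e) (auto simp: signed_graph_def)
        qed
      qed
    next
      case False
      obtain q r s w where p'_eq: "p' = q @ r @ s" and r: "0 < length r" "G.awalk w r w"
        and q: "G.awalk (snd e) q w" and s: "G.awalk w s u"
        using G.awalk_not_distinct_decomp[OF p'] False by auto
      have "G.awalk u (e # q @ s) u"
        using e G.awalk_appendI[OF q s] by (simp add: G.awalk_Cons_iff)
      moreover have "length (e # q @ s) < length p"
        using r(1) p'_eq Cons by simp
      ultimately have "cycle_sign S (e # q @ s) = 1"
        using "1.IH" by blast
      moreover have "length r < length p"
        using p'_eq Cons by simp
      with "1.IH" r(2) have "cycle_sign S r = 1" by blast
      ultimately show ?thesis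
        using Cons p'_eq by simp
    qed
  qed
qed

text \<open>The potential of \<open>v\<close> is the sign of a chosen walk from a root to
  \<open>v\<close>. For an arc \<open>(u, v)\<close>, the walk to \<open>u\<close> extended by the
  arc and the walk to \<open>v\<close> are closed up by one common return walk. Both closed walks
  have sign 1, so the two walks to \<open>v\<close> have equal sign.\<close>

lemma balanced_potential:
  assumes conn: "connected_signed_graph S" and bal: "balanced S"
  obtains \<theta> :: "'a \<Rightarrow> real" where "\<And>v. \<theta> v \<in> {1, - 1}"
    and "\<And>u v. (u, v) \<in> parcs (ugraph S) \<Longrightarrow> signature S (u, v) = \<theta> u * \<theta> v"
proof -
  have S: "signed_graph S" using conn by (simp add: connected_signed_graph_def)
  interpret G: pair_graph "ugraph S" using S by (simp add: signed_graph_def)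
  \<comment> \<open>Connectedness concerns the symmetric closure; symmetry of the arcs turns it into
    directed walks between any two vertices.\<close>
  have "strongly_connected (with_proj (ugraph S))"
    using conn G.symmetric_connected_imp_strongly_connected[OF G.pair_sym_arcs]
    by (simp only: connected_signed_graph_def)
  then obtain root where "root \<in> pverts (ugraph S)"
    and reach: "\<And>u v. u \<in> pverts (ugraph S) \<Longrightarrow> v \<in> pverts (ugraph S) \<Longrightarrow> \<exists>p. G.awalk u p v"
    unfolding strongly_connected_def by (auto simp: G.reachable_awalk)
  define W where "W v = (SOME p. G.awalk root p v)" for v
  have W: "G.awalk root (W v) v" if "v \<in> pverts (ugraph S)" for v
    unfolding W_def using reach[OF \<open>root \<in> _\<close> that] by (rule someI_ex)
  \<comment> \<open>The case distinction keeps the values in \<open>{1, - 1}\<close> off the vertex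
    set too, where \<open>W v\<close> is an arbitrary choice.\<close>
  define \<theta> where "\<theta> v = (if cycle_sign S (W v) = 1 then 1 else - 1 :: real)" for v
  have \<theta>: "cycle_sign S (W v) = \<theta> v" if "v \<in> pverts (ugraph S)" for v
    using cycle_sign_values[OF S, of "W v"] W[OF that] by (auto simp: \<theta>_def G.awalk_def)
  have "signature S (u, v) = \<theta> u * \<theta> v" if uv: "(u, v) \<in> parcs (ugraph S)" for u v
  proof -
    have verts: "u \<in> pverts (ugraph S)" "v \<in> pverts (ugraph S)"
      using uv by (auto dest: G.in_arcsD1 G.in_arcsD2)
    obtain q where q: "G.awalk v q root"
      using reach verts \<open>root \<in> _\<close> by blast
    have "G.awalk u [(u, v)] v"
      using uv verts by (simp add: G.awalk_Cons_iff G.awalk_Nil_iff)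
    then have "G.awalk root (W u @ [(u, v)] @ q) root"
      using W verts q by (blast intro: G.awalk_appendI)
    moreover have "G.awalk root (W v @ q) root"
      using W verts q by (blast intro: G.awalk_appendI)
    ultimately have "cycle_sign S (W u @ [(u, v)] @ q) = 1" "cycle_sign S (W v @ q) = 1"
      by (blast intro: balanced_closed_walk_sign[OF S bal])+
    then have "\<theta> u * (signature S (u, v) * cycle_sign S q) = 1" "\<theta> v * cycle_sign S q = 1"
      by (simp_all add: \<theta> verts)
    then show ?thesis
      by (auto simp: \<theta>_def split: if_splits)
  qed
  moreover have "\<theta> v \<in> {1, - 1}" for v by (simp add: \<theta>_def)
  ultimately show thesis using that by blast
qed

section \<open>Strong product with a balanced factor\<close>

lemma Omega_smult:
  assumes "x \<in> Omega k" "c \<in> {1, - 1}"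
  shows "c \<cdot>\<^sub>v x \<in> Omega k"
  using assms by (auto simp: Omega_def)

text \<open>Product arcs inside a copy of the second factor pair the vector of \<open>u\<close> with
  itself, so it must not vanish. A zero vector can occur only at a vertex without arcs, where any
  nonzero vector of \<open>Omega k\<close> may replace it.\<close>

lemma positive_switching_nonzero:
  assumes "positive_switching k S \<zeta>" "1 \<le> k" "signed_graph S"
  obtains \<eta> where "positive_switching k S \<eta>"
    and "\<And>v. v \<in> pverts (ugraph S) \<Longrightarrow> \<eta> v \<bullet> \<eta> v > 0"
proof
  \<comment> \<open>The vector \<open>unit_vec k 0\<close> is nonzero because
    \<open>1 \<le> k\<close>.\<close>
  define \<eta> where "\<eta> v = (if \<zeta> v = 0\<^sub>v k then unit_vec k 0 else \<zeta> v)" for v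
  interpret G: pair_graph "ugraph S" using assms(3) by (simp add: signed_graph_def)
  have \<zeta>: "\<zeta> v \<in> Omega k" "\<zeta> v \<in> carrier_vec k" if "v \<in> pverts (ugraph S)" for v
    using assms(1) that by (auto simp: positive_switching_def Omega_def)
  \<comment> \<open>Hence \<open>\<eta>\<close> agrees with \<open>\<zeta>\<close> at both ends of
    every arc.\<close>
  have "\<zeta> u \<noteq> 0\<^sub>v k \<and> \<zeta> v \<noteq> 0\<^sub>v k" if uv: "(u, v) \<in> parcs (ugraph S)" for u v
  proof -
    have sgn: "signature S (u, v) * sgn (\<zeta> u \<bullet> \<zeta> v) = 1"
      using assms(1) uv unfolding positive_switching_def by blast
    have "\<zeta> u \<in> carrier_vec k" "\<zeta> v \<in> carrier_vec k"
      using uv \<zeta> by (auto dest: G.in_arcsD1 G.in_arcsD2)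
    moreover have "\<zeta> u \<bullet> \<zeta> v \<noteq> 0"
      using sgn by auto
    ultimately show ?thesis by auto
  qed
  moreover have "unit_vec k 0 \<in> Omega k"
    by (auto simp: Omega_def unit_vec_def)
  ultimately show "positive_switching k S \<eta>"
    using assms(1) by (auto simp: positive_switching_def \<eta>_def)
  show "\<eta> v \<bullet> \<eta> v > 0" if "v \<in> pverts (ugraph S)" for v
  proof (cases "\<zeta> v = 0\<^sub>v k")
    case True
    then show ?thesis using assms(2) by (simp add: \<eta>_def)
  next
    case False
    with \<zeta>(2)[OF that] obtain i where i: "i < k" "\<zeta> v $ i \<noteq> 0"
      by (auto simp: vec_eq_iff)
    then have "0 < (\<Sum>i\<in>{0..<k}. \<zeta> v $ i * \<zeta> v $ i)"
      by (intro sum_pos2[of _ i]) (auto simp: zero_less_mult_iff)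
    with False \<zeta>(2)[OF that] show ?thesis
      by (simp add: \<eta>_def scalar_prod_def)
  qed
qed

lemma bdim_strong_product_balanced:
  assumes S: "signed_graph S" and T: "connected_signed_graph T" and bal: "balanced T"
  shows "bdim (strong_product S T) = bdim S"
proof (rule antisym)
  have T': "signed_graph T" using T by (simp add: connected_signed_graph_def)
  have "pverts (ugraph T) \<noteq> {}"
    using T by (auto simp: connected_signed_graph_def Digraph_Component.connected_def
        strongly_connected_def)
  then show "bdim S \<le> bdim (strong_product S T)"
    using bdim_le_strong_product[OF S T'] by blast
  interpret G: pair_graph "ugraph S" using S by (simp add: signed_graph_def)
  define k where "k = bdim S"
  obtain \<zeta> where k: "1 \<le> k" and \<zeta>: "positive_switching k S \<zeta>"
    and pos: "\<And>v. v \<in> pverts (ugraph S) \<Longrightarrow> \<zeta> v \<bullet> \<zeta> v > 0"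
    unfolding k_def using bdim_obtain[OF S] positive_switching_nonzero[OF _ _ S] by metis
  obtain \<theta> :: "'b \<Rightarrow> real" where \<theta>: "\<And>v. \<theta> v \<in> {1, - 1}"
    and sig: "\<And>u v. (u, v) \<in> parcs (ugraph T) \<Longrightarrow> signature T (u, v) = \<theta> u * \<theta> v"
    using balanced_potential[OF T bal] by blast
  have sq: "\<theta> v * \<theta> v = 1" for v
    using \<theta>[of v] by auto
  have sgn_\<theta>: "sgn (\<theta> v) = \<theta> v" for v
    using \<theta>[of v] by auto
  have O: "\<zeta> u \<in> Omega k" and carr: "\<zeta> u \<in> carrier_vec k" if "u \<in> pverts (ugraph S)" for u
    using \<zeta> that by (auto simp: positive_switching_def Omega_def)
  let ?\<xi> = "\<lambda>(u, v). \<theta> v \<cdot>\<^sub>v \<zeta> u"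
  have sgn_prod: "sgn (?\<xi> (u, v) \<bullet> ?\<xi> (u', v')) = \<theta> v * \<theta> v' * sgn (\<zeta> u \<bullet> \<zeta> u')"
    if "u \<in> pverts (ugraph S)" "u' \<in> pverts (ugraph S)" for u u' v v'
    using carr[OF that(1)] carr[OF that(2)] by (simp add: sgn_mult sgn_\<theta>)
  have "positive_switching k (strong_product S T) ?\<xi>"
    unfolding positive_switching_def
  proof (intro conjI allI impI ballI)
    show "?\<xi> x \<in> Omega k" if "x \<in> pverts (ugraph (strong_product S T))" for x
      using that O \<theta> Omega_smult by (auto simp: pverts_strong_product)
  next
    fix x y assume xy: "(x, y) \<in> parcs (ugraph (strong_product S T))"
    obtain u v u' v' where eq: "x = (u, v)" "y = (u', v')" by (cases x, cases y)
    have verts: "u \<in> pverts (ugraph S)" "u' \<in> pverts (ugraph S)"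
      using xy by (auto simp: eq in_parcs_strong_product dest: G.in_arcsD1 G.in_arcsD2)
    have one: "signature S (u, u') * sgn (\<zeta> u \<bullet> \<zeta> u') = 1" if "(u, u') \<in> parcs (ugraph S)"
      using \<zeta> that by (simp add: positive_switching_def)
    have two: "signature T (v, v') * (\<theta> v * \<theta> v') = 1" if "(v, v') \<in> parcs (ugraph T)"
      using sq[of v] sq[of v'] by (simp add: sig[OF that] algebra_simps)
    consider (S) "(u, u') \<in> parcs (ugraph S)" "v = v'"
      | (T) "u = u'" "(v, v') \<in> parcs (ugraph T)"
      | (ST) "(u, u') \<in> parcs (ugraph S)" "(v, v') \<in> parcs (ugraph T)"
      using xy by (auto simp: eq in_parcs_strong_product)
    then show "signature (strong_product S T) (x, y) * sgn (?\<xi> x \<bullet> ?\<xi> y) = 1"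
    proof cases
      case S
      then show ?thesis
        unfolding eq sgn_prod[OF verts] signature_strong_product using one sq by simp
    next
      \<comment> \<open>With \<open>u = u'\<close> the factor
        \<open>sgn (\<zeta> u \<bullet> \<zeta> u)\<close> is 1 by \<open>pos\<close>, and only the
        potential remains.\<close>
      case T
      then show ?thesis
        unfolding eq sgn_prod[OF verts] signature_strong_product
        using two arc_neq[OF T'] pos[OF verts(1)] by auto
    next
      case ST
      have "signature S (u, u') * signature T (v, v') * (\<theta> v * \<theta> v' * sgn (\<zeta> u \<bullet> \<zeta> u')) =
          (signature S (u, u') * sgn (\<zeta> u \<bullet> \<zeta> u')) * (signature T (v, v') * (\<theta> v * \<theta> v'))"
        by simp
      with ST show ?thesis
        unfolding eq sgn_prod[OF verts] signature_strong_product
        using one two arc_neq[OF S] arc_neq[OF T'] by auto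
    qed
  qed
  with k show "bdim (strong_product S T) \<le> bdim S"
    unfolding k_def by (rule bdim_le)
qed

theorem theorem2p35:
  fixes S1 :: "'a sgraph" and S2 :: "'b sgraph"
  assumes "connected_signed_graph S1" and "connected_signed_graph S2"
  shows "(balanced S2 \<longrightarrow> bdim (strong_product S1 S2) = bdim S1) \<and>
         (balanced S1 \<longrightarrow> bdim (strong_product S1 S2) = bdim S2)"
proof -
  have "signed_graph S1" "signed_graph S2"
    using assms by (simp_all add: connected_signed_graph_def)
  \<comment> \<open>The second half is the first with the factors exchanged.\<close>
  then show ?thesis
    using assms bdim_strong_product_balanced bdim_strong_product_commute by metis
qed

end
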